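(* Let $p$ be an odd prime, $n\ge 1$, $q=p^n$, and let $\Pi:\mathbb{F}_q\to\mathbb{F}_q$ be a planar function. Let $X$ be the complete set of mutually unbiased bases in $\mathbb{C}^{q}$ given by the planar function construction, that is, the standard basis of $\mathbb{C}^q$ together with all the vectors $$\vec v_{ab}=\frac{1}{\sqrt q}\left(\omega_p^{\mathrm{tr}(a\Pi(x)+bx)}\right)_{x\in\mathbb{F}_q},\qquad a,b\in\mathbb{F}_q.$$ Let $N=\{\vec v_{ab}: a,b\in\mathbb{F}_q\}$ be the set of those vectors of $X$ which are of the form $\frac{1}{\sqrt q}\,\omega_p^{\vec x}$ with $\vec x\in\mathbb{F}_p^{p^n}$, and let $M=\{\vec x\in\mathbb{F}_p^{p^n}: \frac{1}{\sqrt q}\,\omega_p^{\vec x}\in N\}$. Then: 1. $N$ with the operation $\hat\odot$ (and scalar action $\star$) is an $\mathbb{F}_p$-module. 2. $M$ is a $(2n-1)$-dimensional subspace of $PG(p^n-1,p)$; that is, $M$ is an $\mathbb{F}_p$-linear subspace of $\mathbb{F}_p^{p^n}$ of vector space dimension $2n$.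
   Context: Here $\omega_p=e^{2\pi i/p}$ and $\mathrm{tr}:\mathbb{F}_q\to\mathbb{F}_p$ is the absolute trace. A function $\Pi:\mathbb{F}_q\to\mathbb{F}_q$ is planar if for every $c\in\mathbb{F}_q\setminus\{0\}$ the map $x\mapsto \Pi(x+c)-\Pi(x)$ is a bijection of $\mathbb{F}_q$. Coordinates of vectors in $\mathbb{C}^{q}$ and in $\mathbb{F}_p^{p^n}$ are indexed by $x\in\mathbb{F}_q$. For $\vec x=(x_j)\in\mathbb{F}_p^{p^n}$, $\omega_p^{\vec x}$ denotes the complex vector $(\omega_p^{x_j})_j$ (identifying $\mathbb{F}_p=\mathbb{Z}/p\mathbb{Z}$). Let $\odot$ be componentwise multiplication of complex vectors and define $\vec v\,\hat\odot\,\vec u=\dfrac{\vec v\odot\vec u}{|\vec v\odot\vec u|}$, where $|\cdot|$ is the Euclidean norm. The scalar action of $r\in\mathbb{F}_p$ on a vector $\frac{1}{\sqrt q}\omega_p^{\vec x}$ is $r\star\frac{1}{\sqrt q}\omega_p^{\vec x}=\frac{1}{\sqrt q}\omega_p^{r\vec x}$, i.e. it corresponds to scalar multiplication on exponent vectors. $PG(d-1,p)$ is the projective geometry of linear subspaces of $\mathbb{F}_p^d$; its points are the classes $\langle\vec x\rangle=\{\rho\vec x:\rho\in\mathbb{F}_p^*\}$ with $\vec x\ne\vec 0$, and a $k$-dimensional subspace of $PG(d-1,p)$ is a $(k+1)$-dimensional linear subspace of $\mathbb{F}_p^d$. Two orthonormal bases of $\mathbb{C}^d$ are mutually unbiased if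 $|\langle\phi|\psi\rangle|^2=1/d$ for all $\phi$ in the first and $\psi$ in the second; a set of $d+1$ pairwise mutually unbiased bases of $\mathbb{C}^d$ is called complete. *)

theory Defs
  imports
    "HOL-Analysis.Analysis"
    "HOL-Algebra.Module"
    "Berlekamp_Zassenhaus.Finite_Field"
begin

text \<open>
  \<open>'p mod_ring\<close> is \<open>\<int>/p\<int>\<close> for \<open>p = CARD('p)\<close>. For \<open>CARD('q) = p ^ n\<close> the sum
  \<open>x + x ^ p + \<dots> + x ^ (p ^ (n - 1))\<close> lies in the prime subfield of \<open>'q\<close>, which is
  identified with \<open>\<int>/p\<int>\<close> through integer representatives; \<open>of_int_abs_trace\<close> below shows
  that the description is proper.
\<close>

definition abs_trace :: "nat \<Rightarrow> 'q::finite_field \<Rightarrow> 'p::prime_card mod_ring" where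
  "abs_trace n x = (THE c. of_int (to_int_mod_ring c) = (\<Sum>i<n. x ^ (CARD('p) ^ i)))"

definition omega_pow :: "'p::prime_card mod_ring \<Rightarrow> complex" where
  "omega_pow r = exp (2 * pi * \<i> / CARD('p)) ^ nat (to_int_mod_ring r)"

definition planar :: "('q::finite_field \<Rightarrow> 'q) \<Rightarrow> bool" where
  "planar f \<longleftrightarrow> (\<forall>c. c \<noteq> 0 \<longrightarrow> bij (\<lambda>x. f (x + c) - f x))"

definition phase_vec :: "'p::prime_card mod_ring ^ 'd \<Rightarrow> complex ^ 'd" where
  "phase_vec x = (\<chi> j. complex_of_real (1 / sqrt CARD('d)) * omega_pow (x $ j))"

definition odot :: "complex ^ 'd \<Rightarrow> complex ^ 'd \<Rightarrow> complex ^ 'd" where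
  "odot v u = (\<chi> j. v $ j * u $ j)"

definition odot_hat :: "complex ^ 'd \<Rightarrow> complex ^ 'd \<Rightarrow> complex ^ 'd" where
  "odot_hat v u = (1 / norm (odot v u)) *\<^sub>R odot v u"

text \<open>
  Only meaningful on vectors of the form \<open>phase_vec x\<close>; such an \<open>x\<close> is unique
  (\<open>phase_vec_inject\<close>), so the action does not depend on a choice (\<open>star_phase_vec\<close>).
\<close>

definition star :: "'p::prime_card mod_ring \<Rightarrow> complex ^ 'd \<Rightarrow> complex ^ 'd" where
  "star r v = phase_vec (r *s the_inv phase_vec v)"

definition Fp :: "'p::prime_card mod_ring ring" where
  "Fp = \<lparr>carrier = UNIV, monoid.mult = (*), one = 1, zero = 0, add = (+)\<rparr>"

text \<open>
  The record type of modules extends that of rings; the locale \<open>module\<close> puts no condition on the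
  multiplication and unit inherited from that type, which are therefore left undefined.
\<close>

definition phase_module :: "(complex ^ 'd) set \<Rightarrow> ('p::prime_card mod_ring, complex ^ 'd) module" where
  "phase_module S = \<lparr>carrier = S, monoid.mult = undefined, one = undefined,
     zero = phase_vec (0 :: 'p mod_ring ^ 'd), add = odot_hat, smult = star\<rparr>"

text \<open>
  The inner product of the library on \<open>complex ^ 'd\<close> is real-valued, so the Hermitian one is
  introduced here; its norm is the library's Euclidean \<open>norm\<close>.
\<close>

definition cinner :: "complex ^ 'd \<Rightarrow> complex ^ 'd \<Rightarrow> complex" where
  "cinner v w = (\<Sum>j\<in>UNIV. cnj (v $ j) * w $ j)"

definition orthonormal_basis :: "(complex ^ 'd) set \<Rightarrow> bool" where
  "orthonormal_basis B \<longleftrightarrow>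
     (\<forall>v\<in>B. \<forall>w\<in>B. cinner v w = (if v = w then 1 else 0)) \<and> vec.span B = UNIV"

definition mutually_unbiased :: "(complex ^ 'd) set \<Rightarrow> (complex ^ 'd) set \<Rightarrow> bool" where
  "mutually_unbiased B C \<longleftrightarrow> (\<forall>v\<in>B. \<forall>w\<in>C. (cmod (cinner v w))\<^sup>2 = 1 / CARD('d))"

definition complete_MUBs :: "(complex ^ 'd) set set \<Rightarrow> bool" where
  "complete_MUBs X \<longleftrightarrow> card X = CARD('d) + 1 \<and> (\<forall>B\<in>X. orthonormal_basis B) \<and>
     (\<forall>B\<in>X. \<forall>C\<in>X. B \<noteq> C \<longrightarrow> mutually_unbiased B C)"

definition std_basis :: "(complex ^ 'd) set" where
  "std_basis = range (\<lambda>j. axis j 1)"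

definition planar_vec ::
  "('q \<Rightarrow> 'p::prime_card mod_ring) \<Rightarrow> ('q \<Rightarrow> 'q) \<Rightarrow> 'q \<Rightarrow> 'q \<Rightarrow> complex ^ 'q::finite_field" where
  "planar_vec tr f a b = phase_vec (\<chi> x. tr (a * f x + b * x))"

definition planar_MUBs ::
  "('q \<Rightarrow> 'p::prime_card mod_ring) \<Rightarrow> ('q \<Rightarrow> 'q) \<Rightarrow> (complex ^ 'q::finite_field) set set" where
  "planar_MUBs tr f = insert std_basis (range (\<lambda>a. range (planar_vec tr f a)))"

text \<open>
  \<open>S\<close> is a subspace of projective dimension \<open>k\<close> of \<open>PG(m, K)\<close>, the geometry of the linear
  subspaces of \<open>K ^ (m + 1)\<close>. The coordinates of \<open>K ^ (m + 1)\<close> are indexed by an arbitrary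
  type with \<open>m + 1\<close> elements.
\<close>

definition PG_subspace :: "nat \<Rightarrow> nat \<Rightarrow> ('k::field ^ 'd) set \<Rightarrow> bool" where
  "PG_subspace m k S \<longleftrightarrow> CARD('d) = m + 1 \<and> vec.subspace S \<and> vec.dim S = k + 1"

lemma CHAR_eq_CARD:
  assumes "CARD('q::finite_field) = CARD('p::prime_card) ^ n"
  shows "CHAR('q) = CARD('p)"
  using CHAR_dvd_CARD[where 'a='q] assms prime_card[where 'a='p] CHAR_prime[where 'a='q]
  by (metis prime_dvd_power primes_dvd_imp_eq)

lemma embed_inject:
  assumes "CARD('q::finite_field) = CARD('p::prime_card) ^ n"
  shows "(of_int (to_int_mod_ring (a::'p mod_ring)) :: 'q) = of_int (to_int_mod_ring b) \<longleftrightarrow> a = b"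
proof -
  have "a = b" if "[to_int_mod_ring a = to_int_mod_ring b] (mod int CARD('p))"
    using that unfolding cong_def
    by (metis Rep_mod_ring_mod Rep_mod_ring_inject to_int_mod_ring.rep_eq)
  then show ?thesis
    using of_int_eq_iff_cong_CHAR[where 'a='q] CHAR_eq_CARD[OF assms] by metis
qed

lemma embed_add:
  assumes "CARD('q::finite_field) = CARD('p::prime_card) ^ n"
  shows "(of_int (to_int_mod_ring (a + b :: 'p mod_ring)) :: 'q) =
     of_int (to_int_mod_ring a) + of_int (to_int_mod_ring b)"
proof -
  have "to_int_mod_ring (a + b) = (to_int_mod_ring a + to_int_mod_ring b) mod int CARD('p)"
    by (simp add: to_int_mod_ring.rep_eq plus_mod_ring.rep_eq)
  then show ?thesis
    unfolding of_int_add[symmetric] of_int_eq_iff_cong_CHAR CHAR_eq_CARD[OF assms]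
    by (simp add: cong_def)
qed

lemma prime_subfield:
  assumes q: "CARD('q::finite_field) = CARD('p::prime_card) ^ n" and y: "(y::'q) ^ CARD('p) = y"
  shows "\<exists>c::'p mod_ring. of_int (to_int_mod_ring c) = y"
proof -
  let ?p = "CARD('p)" and ?e = "\<lambda>c::'p mod_ring. of_int (to_int_mod_ring c) :: 'q"
  let ?P = "Polynomial.monom 1 ?p - Polynomial.monom 1 1 :: 'q poly"
  have p1: "?p > 1" using nontriv[where 'a='p] .
  have nz: "Polynomial.coeff ?P ?p \<noteq> 0" using p1 by simp
  then have P0: "?P \<noteq> 0" by (metis coeff_0)
  have "degree ?P \<le> ?p"
    using p1 by (intro degree_diff_le) (auto intro: order_trans[OF degree_monom_le])
  moreover have S: "{y. poly ?P y = 0} = {y. y ^ ?p = y}" by (auto simp: poly_monom)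
  ultimately have le: "card {y::'q. y ^ ?p = y} \<le> ?p"
    using card_poly_roots_bound[OF P0] by simp
  have nat: "(of_nat k :: 'q) ^ ?p = of_nat k" for k
  proof (induction k)
    case (Suc k)
    have "(of_nat (Suc k) :: 'q) ^ ?p = (1 + of_nat k) ^ ?p" by simp
    also have "\<dots> = 1 ^ ?p + of_nat k ^ ?p"
      using CHAR_eq_CARD[OF q] by (intro freshmans_dream) (auto simp: prime_card)
    finally show ?case using Suc by simp
  qed (use p1 in simp)
  have sub: "range ?e \<subseteq> {y. y ^ ?p = y}"
  proof clarify
    fix c :: "'p mod_ring"
    have "to_int_mod_ring c \<ge> 0"
      using range_to_int_mod_ring[where 'a='p] by (metis atLeastLessThan_iff rangeI)
    then obtain k where "to_int_mod_ring c = int k" using nonneg_int_cases by blast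
    then show "?e c ^ ?p = ?e c" using nat by simp
  qed
  have "card (range ?e) = ?p"
    using card_image[of ?e UNIV] embed_inject[OF q] by (simp add: inj_on_def)
  then have "range ?e = {y. y ^ ?p = y}" using sub le by (intro card_seteq) auto
  then show ?thesis using y by (metis (mono_tags, lifting) imageE mem_Collect_eq)
qed

lemma of_int_abs_trace:
  assumes q: "CARD('q::finite_field) = CARD('p::prime_card) ^ n"
  shows "of_int (to_int_mod_ring (abs_trace n x :: 'p mod_ring)) = (\<Sum>i<n. (x::'q) ^ (CARD('p) ^ i))"
proof -
  let ?p = "CARD('p)" and ?t = "\<Sum>i<n. x ^ (CARD('p) ^ i)"
  have "?t ^ ?p = (\<Sum>i<n. (x ^ (?p ^ i)) ^ ?p)"
    using CHAR_eq_CARD[OF q] by (intro freshmans_dream_sum) (auto simp: prime_card)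
  also have "\<dots> = (\<Sum>i<n. x ^ (?p ^ Suc i))"
    by (simp add: power_mult[symmetric] mult.commute)
  also have "\<dots> = ?t"
  proof -
    have "(\<Sum>i<Suc n. x ^ (?p ^ i)) = x + (\<Sum>i<n. x ^ (?p ^ Suc i))"
      by (subst sum.lessThan_Suc_shift) simp
    moreover have "(\<Sum>i<Suc n. x ^ (?p ^ i)) = ?t + x"
      using finite_field_power_card_eq_same[of x] q by simp
    ultimately show ?thesis by simp
  qed
  finally obtain c :: "'p mod_ring" where "of_int (to_int_mod_ring c) = ?t"
    using prime_subfield[OF q] by blast
  then show ?thesis unfolding abs_trace_def
    by (rule theI) (metis embed_inject[OF q] \<open>of_int (to_int_mod_ring c) = ?t\<close>)
qed

lemma abs_trace_add:
  assumes q: "CARD('q::finite_field) = CARD('p::prime_card) ^ n"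
  shows "(abs_trace n (x + y :: 'q) :: 'p mod_ring) = abs_trace n x + abs_trace n y"
proof -
  have "(x + y) ^ (CARD('p) ^ i) = x ^ (CARD('p) ^ i) + y ^ (CARD('p) ^ i)" for i
    using CHAR_eq_CARD[OF q] by (intro freshmans_dream') (auto simp: prime_card)
  then have "(of_int (to_int_mod_ring (abs_trace n (x + y) :: 'p mod_ring)) :: 'q) =
    of_int (to_int_mod_ring (abs_trace n x + abs_trace n y :: 'p mod_ring))"
    by (simp add: of_int_abs_trace[OF q] embed_add[OF q] sum.distrib)
  then show ?thesis using embed_inject[OF q] by blast
qed

lemma abs_trace_nonzero:
  assumes q: "CARD('q::finite_field) = CARD('p::prime_card) ^ n"
  shows "\<exists>x::'q. (abs_trace n x :: 'p mod_ring) \<noteq> 0"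
proof (rule ccontr)
  let ?p = "CARD('p)"
  let ?T = "\<Sum>i<n. Polynomial.monom 1 (?p ^ i) :: 'q poly"
  assume "\<not> ?thesis"
  then have 0: "(\<Sum>i<n. (x::'q) ^ (?p ^ i)) = 0" for x
    using of_int_abs_trace[OF q, of x] by simp
  have p1: "?p > 1" using nontriv[where 'a='p] .
  have "card {0, 1::'q} \<le> CARD('q)" by (intro card_mono) auto
  then have "CARD('q) > 1" by simp
  then have n: "n > 0" using q by (cases n) auto
  have "Polynomial.coeff ?T (?p ^ (n - 1)) = (\<Sum>i<n. if i = n - 1 then 1 else 0)"
    using p1 by (intro trans[OF coeff_sum] sum.cong refl) (simp add: power_inject_exp)
  also have "\<dots> = 1" using n by simp
  finally have T0: "?T \<noteq> 0" by force
  have "degree ?T \<le> ?p ^ (n - 1)"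
    using p1 by (intro degree_sum_le) (auto intro!: order_trans[OF degree_monom_le] power_increasing)
  moreover have "{x. poly ?T x = 0} = UNIV" using 0 by (simp add: poly_sum poly_monom)
  ultimately have "CARD('q) \<le> ?p ^ (n - 1)" using card_poly_roots_bound[OF T0] by simp
  moreover have "?p ^ (n - 1) < ?p ^ n" using p1 n by (intro power_strict_increasing) auto
  ultimately show False using q by simp
qed

lemma omega_pow_0 [simp]: "omega_pow 0 = 1"
  by (simp add: omega_pow_def)

lemma omega_pow_add: "omega_pow (r + s) = omega_pow r * omega_pow (s :: 'p::prime_card mod_ring)"
proof -
  let ?p = "CARD('p)" and ?w = "exp (2 * pi * \<i> / CARD('p))"
  have w: "?w ^ ?p = 1" 
    using exp_of_nat_mult[of ?p "2 * pi * \<i> / CARD('p)"] by simp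
  have wm: "?w ^ (k mod ?p) = ?w ^ k" for k
  proof -
    have "?w ^ k = ?w ^ (?p * (k div ?p) + k mod ?p)" by simp
    also have "\<dots> = ?w ^ (k mod ?p)" by (simp only: power_add power_mult w power_one mult_1)
    finally show ?thesis by simp
  qed
  have nn: "to_int_mod_ring t \<ge> 0" for t :: "'p mod_ring"
    using range_to_int_mod_ring[where 'a='p] by (metis atLeastLessThan_iff rangeI)
  have "to_int_mod_ring (r + s) = (to_int_mod_ring r + to_int_mod_ring s) mod int ?p"
    by (simp add: to_int_mod_ring.rep_eq plus_mod_ring.rep_eq)
  then have "nat (to_int_mod_ring (r + s)) = (nat (to_int_mod_ring r) + nat (to_int_mod_ring s)) mod ?p"
    using nn[of r] nn[of s] by (simp add: nat_mod_distrib nat_add_distrib)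
  then show ?thesis unfolding omega_pow_def by (simp only: wm power_add)
qed

lemma norm_omega_pow [simp]: "cmod (omega_pow r) = 1"
  by (simp add: omega_pow_def norm_power)

lemma omega_pow_minus: "omega_pow (- r) = cnj (omega_pow (r :: 'p::prime_card mod_ring))"
proof -
  have "omega_pow (- r) * omega_pow r = 1"
    by (simp add: omega_pow_add[symmetric])
  moreover have "cnj (omega_pow r) * omega_pow r = 1"
    using complex_norm_square[of "omega_pow r"] by (simp add: mult.commute)
  ultimately show ?thesis
    by (metis mult_right_cancel mult_zero_right zero_neq_one)
qed

lemma omega_pow_inject: "omega_pow r = omega_pow (s :: 'p::prime_card mod_ring) \<longleftrightarrow> r = s"
proof
  assume eq: "omega_pow r = omega_pow s"
  have rg: "to_int_mod_ring t \<ge> 0" "to_int_mod_ring t < CARD('p)" for t :: "'p mod_ring"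
    using range_to_int_mod_ring[where 'a='p] by (metis atLeastLessThan_iff rangeI)+
  have *: "omega_pow t = exp (2 * of_real pi * \<i> * of_nat (nat (to_int_mod_ring t)) / of_nat CARD('p))"
    for t :: "'p mod_ring"
    unfolding omega_pow_def exp_of_nat_mult[symmetric] by (simp add: algebra_simps)
  have "nat (to_int_mod_ring r) mod CARD('p) = nat (to_int_mod_ring s) mod CARD('p)"
    using eq complex_root_unity_eq[of "CARD('p)"] unfolding * by (simp add: Suc_leI)
  then have "nat (to_int_mod_ring r) = nat (to_int_mod_ring s)"
    using rg[of r] rg[of s] by (simp add: nat_less_iff)
  then have "to_int_mod_ring r = to_int_mod_ring s"
    using rg(1)[of r] rg(1)[of s] by (metis int_nat_eq)
  then show "r = s" by (metis of_int_mod_ring_to_int_mod_ring)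
qed simp

lemma phase_vec_inject: "phase_vec x = phase_vec y \<longleftrightarrow> x = y"
  by (auto simp: phase_vec_def vec_eq_iff omega_pow_inject)

lemma star_phase_vec: "star r (phase_vec x) = phase_vec (r *s x)"
  unfolding star_def by (subst the_inv_f_f) (auto simp: inj_on_def phase_vec_inject)

lemma norm_phase_vec: "norm (phase_vec x :: complex ^ 'd) = 1"
  by (simp add: norm_vec_def L2_set_def phase_vec_def norm_divide power_divide)

lemma odot_hat_phase_vec:
  "odot_hat (phase_vec x) (phase_vec y) = (phase_vec (x + y) :: complex ^ 'd)"
proof -
  have o: "odot (phase_vec x) (phase_vec y) = (1 / sqrt CARD('d)) *\<^sub>R (phase_vec (x + y) :: complex ^ 'd)"
    by (simp add: odot_def phase_vec_def vec_eq_iff omega_pow_add)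
      (simp add: scaleR_conv_of_real)
  show ?thesis unfolding odot_hat_def o by (simp add: norm_phase_vec)
qed

lemma character_sum_linear:
  fixes tr :: "'q::finite_field \<Rightarrow> 'p::prime_card mod_ring"
  assumes add: "\<And>x y. tr (x + y) = tr x + tr y" and nz: "\<exists>x. tr x \<noteq> 0" and a: "a \<noteq> 0"
  shows "(\<Sum>x\<in>UNIV. omega_pow (tr (a * x))) = 0"
proof -
  obtain t where t: "tr t \<noteq> 0" using nz by blast
  define u where "u = t / a"
  have "(\<Sum>x\<in>UNIV. omega_pow (tr (a * x))) = (\<Sum>x\<in>UNIV. omega_pow (tr (a * (x + u))))"
    by (rule sum.reindex_bij_witness[of _ "\<lambda>x. x + u" "\<lambda>x. x - u"]) auto
  also have "\<dots> = (\<Sum>x\<in>UNIV. omega_pow (tr (a * x)) * omega_pow (tr t))"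
    using a by (simp add: u_def distrib_left add omega_pow_add)
  also have "\<dots> = (\<Sum>x\<in>UNIV. omega_pow (tr (a * x))) * omega_pow (tr t)"
    by (simp add: sum_distrib_right)
  finally show ?thesis
    using t omega_pow_inject[of "tr t" 0] by (simp add: mult_cancel_left1)
qed

lemma character_sum_planar:
  fixes tr :: "'q::finite_field \<Rightarrow> 'p::prime_card mod_ring"
  assumes add: "\<And>x y. tr (x + y) = tr x + tr y" and nz: "\<exists>x. tr x \<noteq> 0" and a: "a \<noteq> 0"
    and f: "planar f"
  shows "(cmod (\<Sum>x\<in>UNIV. omega_pow (tr (a * f x + b * x))))\<^sup>2 = CARD('q)"
proof -
  let ?g = "\<lambda>x. a * f x + b * x"
  let ?S = "\<Sum>x\<in>UNIV. omega_pow (tr (?g x))"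
  have tr0: "tr 0 = 0" using add[of 0 0] by (metis add.right_neutral add_left_cancel)
  have minus: "tr (x - y) = tr x - tr y" for x y
    using add[of "x - y" y] by simp
  have char_diff: "omega_pow (tr (x - y)) = omega_pow (tr x) * cnj (omega_pow (tr y))" for x y
    using omega_pow_add[of "tr x" "- tr y"] unfolding minus omega_pow_minus by simp
  have "of_real ((cmod ?S)\<^sup>2) = ?S * cnj ?S" by (rule complex_norm_square)
  also have "\<dots> = (\<Sum>y\<in>UNIV. \<Sum>x\<in>UNIV. omega_pow (tr (?g x - ?g y)))"
    unfolding cnj_sum sum_product char_diff by (rule sum.swap)
  also have "\<dots> = (\<Sum>y\<in>UNIV. \<Sum>c\<in>UNIV. omega_pow (tr (?g (y + c) - ?g y)))"
  proof (rule sum.cong[OF refl])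
    fix y
    show "(\<Sum>x\<in>UNIV. omega_pow (tr (?g x - ?g y))) = (\<Sum>c\<in>UNIV. omega_pow (tr (?g (y + c) - ?g y)))"
      by (rule sum.reindex_bij_witness[of _ "\<lambda>c. y + c" "\<lambda>x. x - y"]) auto
  qed
  also have "\<dots> = (\<Sum>c\<in>UNIV. \<Sum>y\<in>UNIV. omega_pow (tr (?g (y + c) - ?g y)))"
    by (rule sum.swap)
  also have "\<dots> = (\<Sum>c\<in>(UNIV::'q set). if c = 0 then of_nat CARD('q) else 0)"
  proof (rule sum.cong[OF refl])
    fix c :: 'q
    show "(\<Sum>y\<in>UNIV. omega_pow (tr (?g (y + c) - ?g y))) = (if c = 0 then of_nat CARD('q) else 0)"
    proof (cases "c = 0")
      case False
      then have bij: "bij (\<lambda>y. f (y + c) - f y)" using f by (simp add: planar_def)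
      have "?g (y + c) - ?g y = a * (f (y + c) - f y) + b * c" for y
        by (simp add: algebra_simps)
      then have "(\<Sum>y\<in>UNIV. omega_pow (tr (?g (y + c) - ?g y))) =
          (\<Sum>y\<in>UNIV. omega_pow (tr (a * (f (y + c) - f y)))) * omega_pow (tr (b * c))"
        by (simp add: add omega_pow_add sum_distrib_right)
      also have "(\<Sum>y\<in>UNIV. omega_pow (tr (a * (f (y + c) - f y)))) = (\<Sum>z\<in>UNIV. omega_pow (tr (a * z)))"
        using sum.reindex_bij_betw[OF bij, of "\<lambda>z. omega_pow (tr (a * z))"] by simp
      also have "\<dots> = 0" using add nz a by (rule character_sum_linear)
      finally show ?thesis using False by simp
    qed (simp add: tr0)
  qed
  also have "\<dots> = of_real (real CARD('q))" by simp
  finally show ?thesis by (simp only: of_real_eq_iff)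
qed

lemma orthonormal_basisI:
  fixes e :: "'d \<Rightarrow> complex ^ 'd"
  assumes e: "\<And>i j. cinner (e i) (e j) = (if i = j then 1 else 0)"
  shows "orthonormal_basis (range e)"
proof -
  have inj: "inj e"
  proof (rule injI)
    fix i j assume "e i = e j"
    then show "i = j" using e[of i j] e[of i i] by (simp split: if_splits)
  qed
  have ip: "cinner v w = (if v = w then 1 else 0)" if "v \<in> range e" "w \<in> range e" for v w
    using that e inj by (auto simp: inj_eq)
  have "vec.independent (range e)"
  proof (rule vec.independent_if_scalars_zero)
    fix u x assume 0: "(\<Sum>v\<in>range e. u v *s v) = 0" and x: "x \<in> range e"
    have "0 = cinner x (\<Sum>v\<in>range e. u v *s v)" unfolding 0 by (simp add: cinner_def)
    also have "\<dots> = (\<Sum>j\<in>UNIV. \<Sum>v\<in>range e. u v * (cnj (x $ j) * v $ j))"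
      by (simp add: cinner_def sum_component sum_distrib_left mult_ac)
    also have "\<dots> = (\<Sum>v\<in>range e. u v * cinner x v)"
      by (subst sum.swap) (simp only: cinner_def sum_distrib_left)
    also have "\<dots> = (\<Sum>v\<in>range e. if v = x then u v else 0)"
      by (rule sum.cong) (auto simp: ip[OF x])
    also have "\<dots> = u x" using x by simp
    finally show "u x = 0" by simp
  qed simp
  moreover have "card (range e) = vec.dim (UNIV :: (complex ^ 'd) set)"
    using card_image[OF inj] by (simp add: card_cart_basis)
  ultimately have "vec.span (range e) = UNIV"
    using vec.card_eq_dim[of "range e" UNIV] by auto
  then show ?thesis using ip by (auto simp: orthonormal_basis_def)
qed

lemma cinner_planar_vec:
  fixes tr :: "'q::finite_field \<Rightarrow> 'p::prime_card mod_ring"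
  assumes add: "\<And>x y. tr (x + y) = tr x + tr y"
  shows "cinner (planar_vec tr f a b) (planar_vec tr f c d) =
    (\<Sum>x\<in>UNIV. omega_pow (tr ((c - a) * f x + (d - b) * x))) / of_nat CARD('q)"
proof -
  have minus: "tr (x - y) = tr x - tr y" for x y
    using add[of "x - y" y] by simp
  have char_diff: "omega_pow (tr (x - y)) = cnj (omega_pow (tr y)) * omega_pow (tr x)" for x y
    using omega_pow_add[of "tr x" "- tr y"] unfolding minus omega_pow_minus by (simp add: mult.commute)
  have s: "complex_of_real (sqrt CARD('q)) * complex_of_real (sqrt CARD('q)) = of_nat CARD('q)"
    by (simp flip: of_real_mult)
  have "cnj (planar_vec tr f a b $ x) * planar_vec tr f c d $ x =
      omega_pow (tr ((c - a) * f x + (d - b) * x)) / of_nat CARD('q)" for x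
  proof -
    have "(c - a) * f x + (d - b) * x = (c * f x + d * x) - (a * f x + b * x)"
      by (simp add: algebra_simps)
    then show ?thesis
      by (simp only: char_diff s[symmetric]) (simp add: planar_vec_def phase_vec_def)
  qed
  then show ?thesis by (simp add: cinner_def sum_divide_distrib)
qed

lemma complete_MUBs_planar_MUBs:
  fixes f :: "'q::finite_field \<Rightarrow> 'q" and tr :: "'q \<Rightarrow> 'p::prime_card mod_ring"
  assumes add: "\<And>x y. tr (x + y) = tr x + tr y" and nz: "\<exists>x. tr x \<noteq> 0" and f: "planar f"
  shows "complete_MUBs (planar_MUBs tr f)"
proof -
  let ?v = "planar_vec tr f"
  have tr0: "tr 0 = 0" using add[of 0 0] by (metis add.right_neutral add_left_cancel)
  have ip: "cinner (?v a b) (?v a d) = (if b = d then 1 else 0)" for a b d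
    using character_sum_linear[of tr "d - b", OF add nz]
    by (auto simp: cinner_planar_vec[OF add] tr0)
  have mu: "(cmod (cinner (?v a b) (?v c d)))\<^sup>2 = 1 / CARD('q)" if "a \<noteq> c" for a b c d
    using character_sum_planar[of tr "c - a" f "d - b", OF add nz _ f] that
    by (simp add: cinner_planar_vec[OF add] norm_divide power_divide power2_eq_square)
  have st: "(cmod (cinner (axis i 1) (?v a b)))\<^sup>2 = 1 / CARD('q)"
    "(cmod (cinner (?v a b) (axis i 1)))\<^sup>2 = 1 / CARD('q)" for i a b
    by (simp_all add: cinner_def axis_def if_distrib if_distribR cong: if_cong)
      (simp_all add: planar_vec_def phase_vec_def norm_divide power_divide)
  have "card {0, 1::'q} \<le> CARD('q)" by (intro card_mono) auto
  then have q1: "CARD('q) > 1" by simp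
  have ob_std: "orthonormal_basis (std_basis :: (complex ^ 'q::finite_field) set)"
    unfolding std_basis_def
  proof (rule orthonormal_basisI)
    fix i j :: 'q
    have "cnj (axis i 1 $ k) * axis j 1 $ k = (if k = i then if i = j then 1 else 0 else (0::complex))" for k
      by (simp add: axis_def)
    then show "cinner (axis i 1) (axis j 1) = (if i = j then 1 else 0)"
      by (simp add: cinner_def)
  qed
  have ob: "orthonormal_basis (range (?v a))" for a
    by (rule orthonormal_basisI) (rule ip)
  have ne: "range (?v a) \<noteq> range (?v c)" if "a \<noteq> c" for a c
  proof
    assume "range (?v a) = range (?v c)"
    then obtain d where "?v a 0 = ?v c d" by blast
    then show False using mu[OF that, of 0 d] ip[of a 0 0] q1 by simp
  qed
  have ne_std: "std_basis \<noteq> range (?v a)" for a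
  proof
    assume "std_basis = range (?v a)"
    then obtain i :: 'q where "?v a 0 = axis i 1" unfolding std_basis_def by blast
    then show False using st(1)[of i a 0] ip[of a 0 0] q1 by simp
  qed
  have "card (range (\<lambda>a. range (?v a))) = CARD('q)"
    using ne by (intro card_image) (auto simp: inj_on_def)
  then have "card (planar_MUBs tr f) = CARD('q) + 1"
    unfolding planar_MUBs_def using ne_std by (subst card_insert_disjoint) auto
  moreover have "orthonormal_basis B" if "B \<in> planar_MUBs tr f" for B
    using that ob ob_std by (auto simp: planar_MUBs_def)
  moreover have "mutually_unbiased B C"
    if "B \<in> planar_MUBs tr f" "C \<in> planar_MUBs tr f" "B \<noteq> C" for B C
  proof -
    have "mutually_unbiased (range (?v a)) (range (?v c))" if "a \<noteq> c" for a c
      using mu[OF that] by (auto simp: mutually_unbiased_def)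
    moreover have "mutually_unbiased std_basis (range (?v a))"
      "mutually_unbiased (range (?v a)) std_basis" for a
      using st by (auto simp: mutually_unbiased_def std_basis_def)
    ultimately show ?thesis
      using that unfolding planar_MUBs_def by (metis (no_types, lifting) insertE imageE)
  qed
  ultimately show ?thesis by (auto simp: complete_MUBs_def)
qed

lemma phase_vectors_in_planar_MUBs:
  fixes f :: "'q::finite_field \<Rightarrow> 'q" and tr :: "'q \<Rightarrow> 'p::prime_card mod_ring"
  shows "{v \<in> \<Union>(planar_MUBs tr f). \<exists>x :: 'p mod_ring ^ 'q::finite_field. v = phase_vec x} =
    {planar_vec tr f a b | a b. True}"
proof -
  have "card {0, 1::'q} \<le> CARD('q)" by (intro card_mono) auto
  then have q1: "CARD('q) > 1" by simp
  have ne: "axis i 1 \<noteq> (phase_vec x :: complex ^ 'q::finite_field)" for i and x :: "'p mod_ring ^ 'q::finite_field"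
  proof
    assume "axis i 1 = (phase_vec x :: complex ^ 'q::finite_field)"
    then have "cmod (axis i 1 $ i :: complex) = cmod (phase_vec x $ i)" by simp
    then show False using q1 by (simp add: phase_vec_def norm_divide)
  qed
  show ?thesis (is "?L = ?R")
  proof
    show "?L \<subseteq> ?R"
      unfolding planar_MUBs_def std_basis_def using ne by blast
    show "?R \<subseteq> ?L"
    proof clarify
      fix a b
      have "planar_vec tr f a b \<in> \<Union>(planar_MUBs tr f)" by (auto simp: planar_MUBs_def)
      then show "planar_vec tr f a b \<in> \<Union>(planar_MUBs tr f) \<and>
          (\<exists>x :: 'p mod_ring ^ 'q::finite_field. planar_vec tr f a b = phase_vec x)"
        unfolding planar_vec_def by blast
    qed
  qed
qed

lemma complete_MUBs_abs_trace:
  fixes f :: "'q::finite_field \<Rightarrow> 'q"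
  assumes "CARD('q) = CARD('p::prime_card) ^ n" and "planar f"
  shows "complete_MUBs (planar_MUBs (abs_trace n :: 'q \<Rightarrow> 'p mod_ring) f)"
  using complete_MUBs_planar_MUBs[OF abs_trace_add abs_trace_nonzero] assms by blast

end

theory Submission
  imports Defs
begin

text \<open>
  The map \<open>(a, b) \<mapsto> (tr (a * \<Pi> x + b * x))\<^sub>x\<close> is additive, so its range \<open>M\<close> is closed under
  addition and hence a subspace, the scalars being integer multiples. It is injective because the
  character sum of \<open>a * \<Pi> x + b * x\<close> would be \<open>q\<close> for \<open>(a, b)\<close> in the kernel, whereas it
  has absolute value \<open>sqrt q\<close> if \<open>a \<noteq> 0\<close> and \<open>0\<close> if \<open>a = 0 \<noteq> b\<close>. So \<open>M\<close> has \<open>q\<^sup>2\<close>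
  elements, i.e. dimension \<open>2 * n\<close>. The map \<open>phase_vec\<close> transports the structure of \<open>M\<close> to \<open>N\<close>.
\<close>

lemma cring_Fp: "cring Fp"
proof (rule cringI)
  show "abelian_group (Fp :: 'p::prime_card mod_ring ring)"
    by (rule abelian_groupI) (auto simp: Fp_def ac_simps intro: exI[of _ "- x" for x] left_minus)
  show "Group.comm_monoid (Fp :: 'p::prime_card mod_ring ring)"
    by (rule comm_monoidI) (auto simp: Fp_def ac_simps)
qed (auto simp: Fp_def distrib_right)

text \<open>Every scalar of the prime field is a natural number multiple of 1, so scaling is
  iterated addition.\<close>

lemma subspace_mod_ringI:
  fixes S :: "('p::prime_card mod_ring ^ 'd) set"
  assumes zero: "0 \<in> S" and add: "\<And>x y. x \<in> S \<Longrightarrow> y \<in> S \<Longrightarrow> x + y \<in> S"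
  shows "vec.subspace S"
proof (rule vec.subspaceI)
  fix r :: "'p mod_ring" and x assume x: "x \<in> S"
  have "of_nat k *s x \<in> S" for k
  proof (induction k)
    case (Suc k)
    then show ?case
      by (simp only: of_nat_Suc vec.scale_left_distrib vec.scale_one add x)
  qed (simp add: zero)
  moreover have "to_int_mod_ring r \<ge> 0"
    using range_to_int_mod_ring[where 'a='p] by (metis atLeastLessThan_iff rangeI)
  then have "r = of_nat (nat (to_int_mod_ring r))"
    by (metis of_int_mod_ring_to_int_mod_ring of_int_of_int_mod_ring of_nat_nat)
  ultimately show "r *s x \<in> S" by metis
qed (use assms in auto)

text \<open>Taking linear combinations of a basis \<open>B\<close> of \<open>S\<close> is a
  bijection from the coefficient functions on \<open>B\<close> onto \<open>S\<close>.\<close>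

lemma card_subspace:
  fixes S :: "('k::{field,finite} ^ 'd) set"
  assumes "vec.subspace S"
  shows "card S = CARD('k) ^ vec.dim S"
proof -
  obtain B where B: "B \<subseteq> S" "vec.independent B" "S \<subseteq> vec.span B" "card B = vec.dim S"
    by (rule vec.basis_exists)
  have fin: "finite B" using B(2) by (rule vec.finiteI_independent)
  have S: "S = vec.span B" using B assms by (metis subset_antisym vec.span_minimal)
  let ?F = "\<lambda>u. \<Sum>v\<in>B. u v *s v"
  have "inj_on ?F (B \<rightarrow>\<^sub>E UNIV)"
  proof (rule inj_onI)
    fix u w assume u: "u \<in> B \<rightarrow>\<^sub>E UNIV" and w: "w \<in> B \<rightarrow>\<^sub>E UNIV" and eq: "?F u = ?F w"
    have "(\<Sum>v\<in>B. (u v - w v) *s v) = 0"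
      using eq by (simp add: vec.scale_left_diff_distrib sum_subtractf)
    then have "u v - w v = 0" if "v \<in> B" for v
      by (rule vec.independentD[OF B(2) fin subset_refl _ that])
    then show "u = w" using u w by (intro PiE_ext) auto
  qed
  moreover have "?F ` (B \<rightarrow>\<^sub>E UNIV) = S"
  proof -
    \<comment> \<open>The sum sees only the values of \<open>u\<close> on \<open>B\<close>, so an
      arbitrary coefficient function may be replaced by its restriction, which is
      extensional.\<close>
    have "?F u \<in> ?F ` (B \<rightarrow>\<^sub>E UNIV)" for u
      by (rule image_eqI[of _ _ "restrict u B"]) auto
    then show ?thesis unfolding S vec.span_finite[OF fin] by blast
  qed
  ultimately have "card S = card (B \<rightarrow>\<^sub>E (UNIV :: 'k set))"
    using card_image[of ?F "B \<rightarrow>\<^sub>E UNIV"] by simp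
  then show ?thesis using fin B(4) by (simp add: card_PiE)
qed

text \<open>\<open>phase_vec\<close> turns \<open>+\<close> into \<open>odot_hat\<close> and
  \<open>*s\<close> into \<open>star\<close>, so each module axiom for the image is the
  corresponding vector space law in \<open>S\<close>.\<close>

lemma module_phase_module:
  fixes S :: "('p::prime_card mod_ring ^ 'd) set"
  assumes "vec.subspace S"
  shows "Module.module (Fp :: 'p mod_ring ring) (phase_module (phase_vec ` S))"
proof (rule moduleI[OF cring_Fp])
  note sub = vec.subspace_0[OF assms] vec.subspace_add[OF assms] vec.subspace_scale[OF assms]
    vec.subspace_neg[OF assms]
  let ?P = "phase_module (phase_vec ` S) :: ('p mod_ring, complex ^ 'd) module"
  show "abelian_group ?P"
  proof (rule abelian_groupI)
    fix v assume "v \<in> carrier ?P"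
    then obtain x where x: "x \<in> S" "v = phase_vec x" by (auto simp: phase_module_def)
    then have "phase_vec (- x) \<in> carrier ?P" "phase_vec (- x) \<oplus>\<^bsub>?P\<^esub> v = \<zero>\<^bsub>?P\<^esub>"
      by (simp_all add: phase_module_def odot_hat_phase_vec sub)
    then show "\<exists>w\<in>carrier ?P. w \<oplus>\<^bsub>?P\<^esub> v = \<zero>\<^bsub>?P\<^esub>" by blast
  qed (auto simp: phase_module_def odot_hat_phase_vec sub ac_simps)
qed (auto simp: phase_module_def Fp_def odot_hat_phase_vec star_phase_vec
    vec.subspace_scale[OF assms] vec.scale_left_distrib vec.scale_right_distrib)

text \<open>The parameters form a pair so that this is one additive map on
  \<open>'q \<times> 'q\<close>, whose injectivity can be read off from its kernel.\<close>

definition planar_exponent ::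
  "('q \<Rightarrow> 'p) \<Rightarrow> ('q \<Rightarrow> 'q) \<Rightarrow> 'q \<times> 'q \<Rightarrow> 'p ^ 'q::finite_field" where
  "planar_exponent tr f = (\<lambda>(a, b). \<chi> x. tr (a * f x + b * x))"

context
  fixes f :: "'q::finite_field \<Rightarrow> 'q" and tr :: "'q \<Rightarrow> 'p::prime_card mod_ring"
  assumes add: "\<And>x y. tr (x + y) = tr x + tr y"
begin

lemma planar_exponent_add:
  "planar_exponent tr f (u + v) = planar_exponent tr f u + planar_exponent tr f v"
  by (cases u; cases v)
    (simp add: planar_exponent_def vec_eq_iff add[symmetric] algebra_simps)

lemma planar_exponent_zero: "planar_exponent tr f 0 = 0"
  using planar_exponent_add[of 0 0] by simp

lemma subspace_range_planar_exponent: "vec.subspace (range (planar_exponent tr f))"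
proof (rule subspace_mod_ringI)
  show "0 \<in> range (planar_exponent tr f)" by (metis planar_exponent_zero rangeI)
qed (auto simp flip: planar_exponent_add)

lemma inj_planar_exponent:
  assumes nz: "\<exists>x. tr x \<noteq> 0" and f: "planar f"
  shows "inj (planar_exponent tr f)"
proof (rule injI)
  fix u v assume eq: "planar_exponent tr f u = planar_exponent tr f v"
  obtain a b where ab: "u - v = (a, b)" by fastforce
  have "planar_exponent tr f (u - v) = 0"
    using planar_exponent_add[of "u - v" v] eq by simp
  then have "tr (a * f x + b * x) = 0" for x
    by (simp add: ab planar_exponent_def vec_eq_iff)
  then have sum: "(\<Sum>x\<in>UNIV. omega_pow (tr (a * f x + b * x))) = of_nat CARD('q)" by simp
  have "card {0, 1::'q} \<le> CARD('q)" by (intro card_mono) auto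
  then have q1: "CARD('q) > 1" by simp
  \<comment> \<open>Otherwise planarity makes the squared modulus of the sum q, while its value q
    gives q squared.\<close>
  have "a = 0"
  proof (rule ccontr)
    assume "a \<noteq> 0"
    then have "(real CARD('q))\<^sup>2 = real CARD('q)"
      using character_sum_planar[of tr a f b, OF add nz _ f] sum by simp
    then show False using q1 by (simp add: power2_eq_square)
  qed
  \<comment> \<open>For \<open>a = 0\<close> and \<open>b \<noteq> 0\<close> the sum runs over a
    nontrivial additive character and vanishes, contradicting its value q.\<close>
  moreover have "b = 0"
    using character_sum_linear[of tr b, OF add nz] sum \<open>a = 0\<close> by auto
  ultimately show "u = v" using ab by (simp add: zero_prod_def[symmetric])
qed

end

theorem theorem11:
  fixes p n q :: nat
    and Pl :: "'q::finite_field \<Rightarrow> 'q"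
    and tr :: "'q \<Rightarrow> 'p::prime_card mod_ring"
    and X :: "(complex ^ 'q::finite_field) set set"
    and N :: "(complex ^ 'q::finite_field) set"
    and M :: "('p mod_ring ^ 'q::finite_field) set"
  assumes "CARD('p) = p" and "odd p" and "n \<ge> 1" and "q = p ^ n" and "CARD('q) = q"
    and "planar Pl"
    and "tr = abs_trace n"
    and "X = planar_MUBs tr Pl"
    and "N = {v \<in> \<Union>X. \<exists>x :: 'p mod_ring ^ 'q::finite_field. v = phase_vec x}"
    and "M = {x. phase_vec x \<in> N}"
  shows "Module.module (Fp :: 'p mod_ring ring) (phase_module N) \<and>
    PG_subspace (p ^ n - 1) (2 * n - 1) M \<and> vec.subspace M \<and> vec.dim M = 2 * n"
proof -
  have q: "CARD('q) = CARD('p) ^ n" using assms by simp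
  have add: "tr (x + y) = tr x + tr y" for x y
    using abs_trace_add[OF q] assms(7) by simp
  have nz: "\<exists>x. tr x \<noteq> 0" using abs_trace_nonzero[OF q] assms(7) by simp
  \<comment> \<open>The standard basis drops out: its vectors have a coordinate 1, whereas phase
    vectors have all moduli 1 / sqrt q < 1.\<close>
  have "N = {planar_vec tr Pl a b | a b. True}"
    unfolding assms(8,9) by (rule phase_vectors_in_planar_MUBs)
  moreover have "planar_vec tr Pl a b = phase_vec (planar_exponent tr Pl (a, b))" for a b
    by (simp add: planar_vec_def planar_exponent_def)
  ultimately have N: "N = phase_vec ` range (planar_exponent tr Pl)" by auto
  then have M: "M = range (planar_exponent tr Pl)"
    by (auto simp: assms(10) phase_vec_inject)
  have sub: "vec.subspace M"
    unfolding M using add by (rule subspace_range_planar_exponent)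
  have p1: "CARD('p) > 1" using nontriv[where 'a='p] .
  \<comment> \<open>Counting \<open>M\<close> by parameters and by dimension gives two powers of p >
    1, whose exponents must agree.\<close>
  have "card M = CARD('q \<times> 'q)"
    unfolding M using inj_planar_exponent[OF add nz assms(6)] by (rule card_image)
  also have "\<dots> = CARD('p) ^ (2 * n)"
    using q by (simp add: power_mult power2_eq_square mult_2 power_add)
  finally have "CARD('p) ^ vec.dim M = CARD('p) ^ (2 * n)"
    using card_subspace[OF sub] by simp
  then have dim: "vec.dim M = 2 * n" using p1 by simp
  \<comment> \<open>Since \<open>n \<ge> 1\<close> and \<open>p ^ n > 0\<close>, neither truncated
    subtraction loses anything when 1 is added back.\<close>
  moreover have "PG_subspace (p ^ n - 1) (2 * n - 1) M"
    using dim sub assms(1,3) q p1 by (simp add: PG_subspace_def)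
  moreover have "Module.module (Fp :: 'p mod_ring ring) (phase_module N)"
    using module_phase_module[OF sub] unfolding N M .
  ultimately show ?thesis using sub by simp
qed

end
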